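(* Let $G$ be a connected graph on $n$ vertices. If $G$ contains no heavy cycles, then $G$ has at most two heavy vertices. Moreover, still assuming that $G$ contains no heavy cycles: (1) if $G$ contains no heavy vertices, then $G$ is a tree; (2) if $G$ contains only one heavy vertex, say $x$, then $G-x$ contains at least $n/2$ components, and each component of $G-x$ contains exactly one neighbor of $x$; (3) if $G$ has exactly two heavy vertices, say $x$ and $y$, then $xy\in E(G)$ and $xy$ is a cut edge of $G$, $n$ is even and both components of $G-xy$ have $n/2$ vertices, $x$ is adjacent to every other vertex of the component of $G-xy$ which contains $x$, and $y$ is adjacent to every other vertex of the component of $G-xy$ which contains $y$. Briefly stated, $T_1\subseteq G\subseteq T_2$.
   Context: All graphs are finite and simple. Let $G$ be a graph on $n$ vertices. A vertex $v$ of $G$ is called heavy if its degree satisfies $d(v)\geq n/2$. A cycle $C$ of $G$ is called heavy if $C$ contains all heavy vertices of $G$ (in particular, if $G$ has no heavy vertices then every cycle of $G$ is heavy). For a vertex $x$, $G-x$ is the graph obtained from $G$ by deleting $x$; for an edge $e=xy$, $G-xy$ is the graph obtained from $G$ by deleting the edge $e$ (keeping its endpoints). For even $n$, $T_1$ is the graph on $n$ vertices $x,x_1,\dots,x_{n/2-1},y,y_1,\dots,y_{n/2-1}$ whose edges are $xy$, all $xx_i$ and all $yy_i$ ($1\le i\le n/2-1$); $T_2$ is the graph on the same vertex set whose edges are $xy$ together with all edges within $\{x,x_1,\dots,x_{n/2-1}\}$ and all edges within $\{y,y_1,\dots,y_{n/2-1}\}$ (two disjoint complete graphs $K_{n/2}$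 joined by the edge $xy$). The inclusion $T_1\subseteq G\subseteq T_2$ means subgraph inclusion for a suitable labelling of the vertices of $G$ other than $x,y$. *)

theory Defs
  imports "Graph_Theory.Graph_Theory"
begin

text \<open>
  Finite simple graphs are rendered by the locale \<^locale>\<open>pair_graph\<close>: a finite vertex set with a
  symmetric, irreflexive set of arcs, where the edge \<open>uv\<close> is the pair of arcs \<open>(u, v)\<close>, \<open>(v, u)\<close>.
  The degree of a vertex is its out-degree. Note that \<^const>\<open>connected\<close> excludes the empty graph.
\<close>

definition order :: "'a pair_pre_digraph \<Rightarrow> nat" where
  "order G = card (pverts G)"

definition heavy_verts :: "'a pair_pre_digraph \<Rightarrow> 'a set" where
  "heavy_verts G = {v \<in> pverts G. real (out_degree G v) \<ge> real (order G) / 2}"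

text \<open>
  \<^const>\<open>pre_digraph.cycle\<close> also admits the walk \<open>u, v, u\<close> along the two arcs of one edge. Requiring
  length at least 3 excludes it and leaves exactly the cycles of the undirected graph. For the same
  reason \<^const>\<open>tree\<close> (which is false in a symmetric digraph with an arc) is not used below.
\<close>

definition graph_cycle :: "'a pair_pre_digraph \<Rightarrow> ('a \<times> 'a) awalk \<Rightarrow> bool" where
  "graph_cycle G p \<longleftrightarrow> pre_digraph.cycle G p \<and> length p \<ge> 3"

definition cycle_verts :: "('a \<times> 'a) awalk \<Rightarrow> 'a set" where
  "cycle_verts p = fst ` set p"

definition heavy_cycle :: "'a pair_pre_digraph \<Rightarrow> ('a \<times> 'a) awalk \<Rightarrow> bool" where
  "heavy_cycle G p \<longleftrightarrow> graph_cycle G p \<and> heavy_verts G \<subseteq> cycle_verts p"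

definition graph_tree :: "'a pair_pre_digraph \<Rightarrow> bool" where
  "graph_tree G \<longleftrightarrow> connected G \<and> (\<nexists>p. graph_cycle G p)"

definition delete_vertex :: "'a pair_pre_digraph \<Rightarrow> 'a \<Rightarrow> 'a pair_pre_digraph" where
  "delete_vertex G x =
    \<lparr>pverts = pverts G - {x}, parcs = {e \<in> parcs G. fst e \<noteq> x \<and> snd e \<noteq> x}\<rparr>"

definition delete_edge :: "'a pair_pre_digraph \<Rightarrow> 'a \<Rightarrow> 'a \<Rightarrow> 'a pair_pre_digraph" where
  "delete_edge G x y = \<lparr>pverts = pverts G, parcs = parcs G - {(x, y), (y, x)}\<rparr>"

text \<open>
  The vertex sets of the components: in a symmetric digraph, the strongly connected components are
  the connected components of the undirected graph.
\<close>

definition components :: "'a pair_pre_digraph \<Rightarrow> 'a set set" where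
  "components G = pre_digraph.sccs_verts G"

definition cut_edge :: "'a pair_pre_digraph \<Rightarrow> 'a \<Rightarrow> 'a \<Rightarrow> bool" where
  "cut_edge G x y \<longleftrightarrow>
    (x, y) \<in> parcs G \<and> card (components (delete_edge G x y)) > card (components G)"

text \<open>
  \<open>T\<^sub>1\<close> and \<open>T\<^sub>2\<close> on the vertices \<open>x, x\<^sub>1, \<dots>, x\<^sub>m, y, y\<^sub>1, \<dots>, y\<^sub>m\<close>, where \<open>xs = [x\<^sub>1, \<dots>, x\<^sub>m]\<close>,
  \<open>ys = [y\<^sub>1, \<dots>, y\<^sub>m]\<close> and \<open>m = n / 2 - 1\<close>; \<^const>\<open>symcl\<close> is the symmetric closure.
\<close>

definition T_labelling :: "nat \<Rightarrow> 'a \<Rightarrow> 'a list \<Rightarrow> 'a \<Rightarrow> 'a list \<Rightarrow> bool" where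
  "T_labelling n x xs y ys \<longleftrightarrow> even n \<and> n \<ge> 2 \<and> distinct (x # xs @ y # ys) \<and>
    length xs = n div 2 - 1 \<and> length ys = n div 2 - 1"

definition T1 :: "'a \<Rightarrow> 'a list \<Rightarrow> 'a \<Rightarrow> 'a list \<Rightarrow> 'a pair_pre_digraph" where
  "T1 x xs y ys =
    \<lparr>pverts = set (x # xs @ y # ys),
     parcs = symcl ({(x, y)} \<union> {x} \<times> set xs \<union> {y} \<times> set ys)\<rparr>"

definition T2 :: "'a \<Rightarrow> 'a list \<Rightarrow> 'a \<Rightarrow> 'a list \<Rightarrow> 'a pair_pre_digraph" where
  "T2 x xs y ys =
    \<lparr>pverts = set (x # xs @ y # ys),
     parcs = symcl ({(x, y)}
       \<union> {(u, v). u \<in> set (x # xs) \<and> v \<in> set (x # xs) \<and> u \<noteq> v}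
       \<union> {(u, v). u \<in> set (y # ys) \<and> v \<in> set (y # ys) \<and> u \<noteq> v})\<rparr>"

end

theory Submission
  imports Defs
begin

text \<open>
  Call a cyclic sequence of distinct vertices an o-cycle if any two consecutive vertices are adjacent
  or have degree sum at least \<open>n\<close>. The vertices of an o-cycle of length at least 3 lie on a common
  cycle: a non-adjacent consecutive pair \<open>u\<close>, \<open>v\<close> either has a common neighbour off the sequence,
  which can be inserted between them, or can be removed by Posa's rotation; both lower the number of
  non-adjacent pairs. Any cyclic ordering of the heavy vertices is an o-cycle, so three or more heavy
  vertices force a heavy cycle. Two heavy vertices \<open>x\<close>, \<open>y\<close> are adjacent (otherwise they have two
  common neighbours, giving a 4-cycle) without common neighbours (no triangle), so their degrees force
  their neighbourhoods to split the remaining vertices evenly, and an edge between the two sides would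
  close a 4-cycle. If \<open>x\<close> is the only heavy vertex, no cycle passes through \<open>x\<close>, so every component
  of \<open>G - x\<close> contains exactly one neighbour of \<open>x\<close>.
\<close>

section \<open>Arcs of vertex lists and of cyclic vertex sequences\<close>

lemma vwalk_arcs_append:
  "vwalk_arcs (xs @ a # ys) = vwalk_arcs (xs @ [a]) @ vwalk_arcs (a # ys)"
  by (induction xs rule: vwalk_arcs.induct) auto

lemma vwalk_arcs_snoc:
  assumes "xs \<noteq> []"
  shows "vwalk_arcs (xs @ [a]) = vwalk_arcs xs @ [(last xs, a)]"
  using assms vwalk_arcs_append[of "butlast xs" "last xs" "[a]"]
  by (cases xs rule: rev_cases) simp_all

lemma vwalk_arcs_rev:
  "vwalk_arcs (rev xs) = rev (map prod.swap (vwalk_arcs xs))"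
proof (induction xs rule: vwalk_arcs.induct)
  case (3 x y xs)
  then show ?case
    using vwalk_arcs_append[of "rev xs" y "[x]"] by simp
qed auto

lemma fst_vwalk_arcs: "map fst (vwalk_arcs xs) = butlast xs"
  by (induction xs rule: vwalk_arcs.induct) auto

lemma set_vwalk_arcs: "set (vwalk_arcs xs) \<subseteq> set xs \<times> set xs"
  by (induction xs rule: vwalk_arcs.induct) auto

lemma in_set_vwalk_arcsD:
  assumes "(a, b) \<in> set (vwalk_arcs xs)"
  shows "\<exists>ys zs. xs = ys @ a # b # zs"
  using assms
proof (induction xs rule: vwalk_arcs.induct)
  case (3 x y xs)
  then show ?case by (auto intro: exI[of _ "[]"]) (metis append_Cons)
qed auto

lemma pcas_vwalk_arcs: "pcas x (vwalk_arcs (x # xs)) (last (x # xs))"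
  by (induction xs arbitrary: x) auto

lemma pawalk_verts_vwalk_arcs: "pawalk_verts x (vwalk_arcs (x # xs)) = x # xs"
  by (induction xs arbitrary: x) auto

lemma vwalk_arcs_pawalk_verts: "pcas x p y \<Longrightarrow> vwalk_arcs (pawalk_verts x p) = p"
proof (induction p arbitrary: x)
  case (Cons e p)
  then show ?case by (cases p) auto
qed simp

text \<open>Repeating the head turns the closing step into an ordinary arc. On \<open>[]\<close> the
  value of \<open>hd []\<close> is immaterial, since a one-vertex list has no arcs.\<close>

definition cyclic_arcs :: "'a list \<Rightarrow> ('a \<times> 'a) list" where
  "cyclic_arcs xs = vwalk_arcs (xs @ [hd xs])"

lemma set_cyclic_arcs: "set (cyclic_arcs xs) \<subseteq> set xs \<times> set xs"
  unfolding cyclic_arcs_def using set_vwalk_arcs[of "xs @ [hd xs]"] by (cases xs) auto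

lemma cyclic_arcs_conv:
  assumes "xs \<noteq> []"
  shows "cyclic_arcs xs = vwalk_arcs xs @ [(last xs, hd xs)]"
  using assms by (simp add: cyclic_arcs_def vwalk_arcs_snoc)

text \<open>Allows a cyclic sequence to be cut open anywhere. Multisets forget the starting point
  but still count the non-adjacent pairs.\<close>

lemma mset_cyclic_arcs_rotate:
  "mset (cyclic_arcs (xs @ ys)) = mset (cyclic_arcs (ys @ xs))"
proof (cases xs; cases ys)
  fix a as b bs assume [simp]: "xs = a # as" "ys = b # bs"
  have "cyclic_arcs (xs @ ys) = vwalk_arcs (xs @ [b]) @ vwalk_arcs (ys @ [a])"
    using vwalk_arcs_append[of xs b "bs @ [a]"] by (simp add: cyclic_arcs_def)
  moreover have "cyclic_arcs (ys @ xs) = vwalk_arcs (ys @ [a]) @ vwalk_arcs (xs @ [b])"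
    using vwalk_arcs_append[of ys a "as @ [b]"] by (simp add: cyclic_arcs_def)
  ultimately show ?thesis by simp
qed auto

text \<open>Chooses the rotation in which \<open>(u, v)\<close> becomes the closing pair of a path
  from \<open>v\<close> to \<open>u\<close>.\<close>

lemma in_set_cyclic_arcsD:
  assumes "(u, v) \<in> set (cyclic_arcs xs)"
  shows "\<exists>ys zs. xs = ys @ zs \<and> zs @ ys \<noteq> [] \<and> hd (zs @ ys) = v \<and> last (zs @ ys) = u"
proof (cases "xs = []")
  case False
  consider "(u, v) \<in> set (vwalk_arcs xs)" | "u = last xs" "v = hd xs"
    using assms cyclic_arcs_conv[OF False] by auto
  then show ?thesis
  proof cases
    case 1
    then obtain ys zs where "xs = ys @ u # v # zs" by (metis in_set_vwalk_arcsD)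
    then show ?thesis by (intro exI[of _ "ys @ [u]"] exI[of _ "v # zs"]) simp
  next
    case 2
    with False show ?thesis by (intro exI[of _ "[]"] exI[of _ xs]) simp
  qed
qed (use assms in \<open>auto simp: cyclic_arcs_def\<close>)

section \<open>Neighbourhoods, and cycles obtained from o-cycles\<close>

context pair_graph begin

abbreviation nbrs :: "'a \<Rightarrow> 'a set" where
  "nbrs v \<equiv> parcs G `` {v}"

lemma nbrs_subset: "nbrs v \<subseteq> pverts G"
  using in_arcsD2 by auto

lemma finite_nbrs: "finite (nbrs v)"
  using finite_subset[OF nbrs_subset] by simp

lemma out_degree_conv: "out_degree G v = card (nbrs v)"
proof -
  have "out_arcs G v = Pair v ` nbrs v" by (auto simp: out_arcs_def)
  then show ?thesis by (simp add: out_degree_def card_image inj_on_def)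
qed

lemma graph_cycle_cyclic_arcs:
  assumes "distinct xs" "length xs \<ge> 3" "set (cyclic_arcs xs) \<subseteq> parcs G"
  shows "graph_cycle G (cyclic_arcs xs)"
proof -
  obtain x ys where xs: "xs = x # ys" using assms(2) by (cases xs) auto
  have "length (cyclic_arcs xs) = length xs"
    using arg_cong[OF fst_vwalk_arcs[of "xs @ [hd xs]"], of length] by (simp add: cyclic_arcs_def)
  moreover have "awalk x (cyclic_arcs xs) x"
  proof -
    \<comment> \<open>The closing arc ends in \<open>x\<close>, which is what places
      \<open>x\<close> in the vertex set.\<close>
    have "(last xs, x) \<in> parcs G"
      using assms(3) by (subst (asm) cyclic_arcs_conv) (simp_all add: xs)
    then have "x \<in> pverts G" by (rule in_arcsD2)
    then show ?thesis
      using assms(3) pcas_vwalk_arcs[of x "ys @ [x]"] by (simp add: awalk_def cyclic_arcs_def xs)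
  qed
  moreover have "distinct (tl (awalk_verts x (cyclic_arcs xs)))"
    using assms(1) pawalk_verts_vwalk_arcs[of x "ys @ [x]"] by (simp add: cyclic_arcs_def xs)
  ultimately show ?thesis
    using assms(2) unfolding graph_cycle_def cycle_def by fastforce
qed

lemma cycle_verts_cyclic_arcs: "cycle_verts (cyclic_arcs xs) = set xs"
proof -
  have "cycle_verts (cyclic_arcs xs) = set (map fst (cyclic_arcs xs))"
    by (simp add: cycle_verts_def)
  then show ?thesis by (simp only: cyclic_arcs_def fst_vwalk_arcs butlast_snoc)
qed

text \<open>
  Posa's crossing argument: if no such pair \<open>a\<close>, \<open>b\<close> existed, the neighbours of the two ends inside
  the path would number less than its length, and the disjoint neighbourhoods outside the path
  cannot make up for the difference.
\<close>

lemma crossing_arcs: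
  assumes "distinct P" "P \<noteq> []" "set P \<subseteq> pverts G"
    and non_adj: "(last P, hd P) \<notin> parcs G"
    and deg: "order G \<le> out_degree G (last P) + out_degree G (hd P)"
    and no_common: "nbrs (last P) \<inter> nbrs (hd P) \<subseteq> set P"
  shows "\<exists>xs a b ys. P = xs @ a # b # ys \<and> (last P, a) \<in> parcs G \<and> (hd P, b) \<in> parcs G"
proof -
  define u v S where "u = last P" and "v = hd P" and "S = set P"
  \<comment> \<open>\<open>I\<close> indexes the consecutive pairs of \<open>P\<close>:
    \<open>A\<close> collects those whose first vertex is adjacent to \<open>u\<close>,
    \<open>B\<close> those whose second vertex is adjacent to \<open>v\<close>. An index in both is
    the crossing sought.\<close>
  define I where "I = {..<length P - 1}"
  define A where "A = {i \<in> I. (u, P ! i) \<in> parcs G}"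
  define B where "B = {i \<in> I. (v, P ! Suc i) \<in> parcs G}"
  have cardS: "card S = length P" "length P > 0"
    using assms(1,2) distinct_card by (auto simp: S_def)
  have fin: "finite A" "finite B" by (auto simp: A_def B_def I_def)
  have u: "u = P ! (length P - 1)" and v: "v = P ! 0"
    using assms(2) by (auto simp: u_def v_def last_conv_nth hd_conv_nth)
  have "nbrs u \<inter> S \<subseteq> (!) P ` A"
  proof
    fix w assume w: "w \<in> nbrs u \<inter> S"
    then obtain i where i: "i < length P" "w = P ! i" by (auto simp: S_def in_set_conv_nth)
    \<comment> \<open>The end \<open>u\<close> sits at the only index outside \<open>I\<close>, and
      it is not its own neighbour. Symmetrically, \<open>v\<close> sits at index 0, the only one
      that is not a successor.\<close>
    have "w \<noteq> u" using w no_loops' by auto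
    with i u have "i \<noteq> length P - 1" by auto
    with i w show "w \<in> (!) P ` A" by (auto simp: A_def I_def)
  qed
  then have cA: "card (nbrs u \<inter> S) \<le> card A"
    using surj_card_le[OF fin(1)] by blast
  have "nbrs v \<inter> S \<subseteq> (\<lambda>i. P ! Suc i) ` B"
  proof
    fix w assume w: "w \<in> nbrs v \<inter> S"
    then obtain i where i: "i < length P" "w = P ! i" by (auto simp: S_def in_set_conv_nth)
    have "w \<noteq> v" using w no_loops' by auto
    with i v have "i \<noteq> 0" by (metis)
    then obtain j where "i = Suc j" by (cases i) auto
    with i w show "w \<in> (\<lambda>i. P ! Suc i) ` B" by (auto simp: B_def I_def)
  qed
  then have cB: "card (nbrs v \<inter> S) \<le> card B"
    using surj_card_le[OF fin(2)] by blast
  have "A \<inter> B \<noteq> {}"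
  proof
    assume "A \<inter> B = {}"
    then have "card A + card B = card (A \<union> B)" using fin by (simp add: card_Un_disjoint)
    also have "\<dots> \<le> card I" by (rule card_mono) (auto simp: A_def B_def I_def)
    finally have AB: "card A + card B \<le> length P - 1" by (simp add: I_def)
    have "card (nbrs u - S) + card (nbrs v - S) = card ((nbrs u - S) \<union> (nbrs v - S))"
      using no_common finite_nbrs by (intro card_Un_disjoint[symmetric]) (auto simp: u_def v_def S_def)
    also have "\<dots> \<le> card (pverts G - S)"
      using nbrs_subset by (intro card_mono) auto
    also have "\<dots> = order G - length P"
      using assms(3) cardS by (subst card_Diff_subset) (auto simp: S_def order_def)
    finally have out: "card (nbrs u - S) + card (nbrs v - S) \<le> order G - length P" .
    \<comment> \<open>Guards the truncated subtraction in \<open>out\<close>.\<close>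
    have "length P \<le> order G"
      using assms(3) cardS card_mono[of "pverts G" S] by (auto simp: S_def order_def)
    have split: "card (nbrs w) = card (nbrs w \<inter> S) + card (nbrs w - S)" for w
      using finite_nbrs by (rule card_Int_Diff)
    with \<open>length P \<le> order G\<close> show False
      using split[of u] split[of v] AB out cA cB deg cardS(2) unfolding out_degree_conv u_def[symmetric] v_def[symmetric]
      by linarith
  qed
  then obtain i where "i \<in> A" "i \<in> B" by auto
  then have i: "Suc i < length P" "(u, P ! i) \<in> parcs G" "(v, P ! Suc i) \<in> parcs G"
    by (auto simp: A_def B_def I_def)
  then have "P = take i P @ P ! i # P ! Suc i # drop (Suc (Suc i)) P"
    by (metis Cons_nth_drop_Suc Suc_lessD id_take_nth_drop)
  with i show ?thesis unfolding u_def v_def by blast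
qed

text \<open>Every non-adjacent pair left after a move is an old one up to reversal, so the degree
  condition persists. The list stays arbitrary in the induction because one move lengthens it and
  the other reorders it.\<close>

lemma cyclic_ore_imp_cycle:
  assumes "distinct xs" "length xs \<ge> 3" "set xs \<subseteq> pverts G"
    and "\<And>a b. (a, b) \<in> set (cyclic_arcs xs) \<Longrightarrow> (a, b) \<notin> parcs G \<Longrightarrow>
      order G \<le> out_degree G a + out_degree G b"
  shows "\<exists>p. graph_cycle G p \<and> set xs \<subseteq> cycle_verts p"
  using assms
proof (induction "length (filter (\<lambda>e. e \<notin> parcs G) (cyclic_arcs xs))" arbitrary: xs
    rule: less_induct)
  case less
  let ?bad = "\<lambda>es. length (filter (\<lambda>e. e \<notin> parcs G) es)"
  show ?case
  proof (cases "set (cyclic_arcs xs) \<subseteq> parcs G")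
    case True
    from graph_cycle_cyclic_arcs[OF less.prems(1,2) this] show ?thesis
      using cycle_verts_cyclic_arcs by (metis order_refl)
  next
    case False
    then obtain u v where uv: "(u, v) \<in> set (cyclic_arcs xs)" "(u, v) \<notin> parcs G" by auto
    obtain ys zs where xs: "xs = ys @ zs"
      and ne: "zs @ ys \<noteq> []" "hd (zs @ ys) = v" "last (zs @ ys) = u"
      using in_set_cyclic_arcsD[OF uv(1)] by (elim exE conjE)
    \<comment> \<open>\<open>P\<close> is the sequence cut open at the bad pair, which thereby
      becomes the closing one and is not counted along \<open>P\<close>.\<close>
    define P where "P = zs @ ys"
    have P: "distinct P" "length P \<ge> 3" "set P = set xs" "P \<noteq> []" "hd P = v" "last P = u"
      using less.prems ne by (auto simp: P_def xs)
    have mset: "mset (cyclic_arcs xs) = mset (vwalk_arcs P) + {#(u, v)#}"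
      using mset_cyclic_arcs_rotate[of ys zs] cyclic_arcs_conv[OF P(4)] P
      by (simp add: xs P_def)
    have bad: "?bad (cyclic_arcs xs) = Suc (?bad (vwalk_arcs P))"
      using arg_cong[OF mset, of "\<lambda>M. size (filter_mset (\<lambda>e. e \<notin> parcs G) M)"] uv(2)
      by (simp flip: mset_filter)
    have ore: "order G \<le> out_degree G a + out_degree G b"
      if "(a, b) \<in> set (vwalk_arcs P)" "(a, b) \<notin> parcs G" for a b
      using less.prems(4) that arg_cong[OF mset, of set_mset] by auto
    have deg: "order G \<le> out_degree G u + out_degree G v"
      using less.prems(4) uv by blast
    show ?thesis
    proof (cases "nbrs u \<inter> nbrs v \<subseteq> set P")
      case False
      then obtain z where z: "(u, z) \<in> parcs G" "(z, v) \<in> parcs G" "z \<notin> set P"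
        using arcs_symmetric by blast
      \<comment> \<open>Appending \<open>z\<close> replaces the bad closing pair by two arcs and
        leaves all other pairs alone.\<close>
      have arcs: "cyclic_arcs (P @ [z]) = vwalk_arcs P @ [(u, z), (z, v)]"
        using P by (simp add: cyclic_arcs_conv vwalk_arcs_snoc)
      have "\<exists>p. graph_cycle G p \<and> set (P @ [z]) \<subseteq> cycle_verts p"
      proof (rule less.hyps)
        show "?bad (cyclic_arcs (P @ [z])) < ?bad (cyclic_arcs xs)"
          using z by (simp add: bad arcs)
        show "set (P @ [z]) \<subseteq> pverts G"
          using P less.prems z in_arcsD2 by auto
      qed (use P z ore in \<open>auto simp: arcs\<close>)
      with P show ?thesis by auto
    next
      case True
      obtain as a b bs where ab: "P = as @ a # b # bs" "(u, a) \<in> parcs G" "(v, b) \<in> parcs G"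
        using crossing_arcs[of P] P True uv deg less.prems by auto
      \<comment> \<open>Reversing the part after \<open>a\<close> yields
        \<open>v ... a u ... b\<close>. The pairs \<open>(a, b)\<close> and \<open>(u, v)\<close>
        give way to the arcs \<open>(a, u)\<close> and \<open>(b, v)\<close>, so the count drops
        whether or not \<open>a\<close> and \<open>b\<close> are adjacent.\<close>
      define Q where "Q = as @ [a] @ rev (b # bs)"
      have Q: "distinct Q" "length Q \<ge> 3" "set Q = set xs"
        using P by (auto simp: Q_def ab)
      have last_b: "last (b # bs) = u" and hd_a: "hd (as @ [a]) = v"
        using P by (auto simp: ab hd_append split: if_splits)
      have arcsP: "vwalk_arcs P = vwalk_arcs (as @ [a]) @ (a, b) # vwalk_arcs (b # bs)"
        using vwalk_arcs_append[of as a "b # bs"] by (simp add: ab)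
      obtain cs where cs: "rev (b # bs) = u # cs"
        using last_b by (metis hd_rev list.collapse rev_is_Nil_conv list.distinct(1))
      have "vwalk_arcs Q = vwalk_arcs (as @ [a]) @ (a, u) # vwalk_arcs (rev (b # bs))"
        using vwalk_arcs_append[of as a "u # cs"] by (simp add: Q_def cs del: rev.simps)
      moreover have "hd Q = v" "last Q = b" "Q \<noteq> []"
        using hd_a by (auto simp: Q_def hd_append split: if_splits)
      ultimately have arcsQ: "cyclic_arcs Q =
          vwalk_arcs (as @ [a]) @ (a, u) # rev (map prod.swap (vwalk_arcs (b # bs))) @ [(b, v)]"
        by (simp add: cyclic_arcs_conv vwalk_arcs_rev del: rev.simps)
      have swap: "prod.swap e \<in> parcs G \<longleftrightarrow> e \<in> parcs G" for e
        using arcs_symmetric by (cases e) auto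
      have au: "(a, u) \<in> parcs G" "(b, v) \<in> parcs G"
        using ab arcs_symmetric by auto
      have "\<exists>p. graph_cycle G p \<and> set Q \<subseteq> cycle_verts p"
      proof (rule less.hyps)
        have "?bad (rev (map prod.swap es)) = ?bad es" for es
          by (simp add: filter_map o_def swap flip: rev_filter)
        then show "?bad (cyclic_arcs Q) < ?bad (cyclic_arcs xs)"
          using au by (simp add: bad arcsQ arcsP del: vwalk_arcs.simps)
        fix c d assume "(c, d) \<in> set (cyclic_arcs Q)" and cd: "(c, d) \<notin> parcs G"
        then have "(c, d) \<in> set (vwalk_arcs P) \<or> (d, c) \<in> set (vwalk_arcs P)"
          using au by (auto simp: arcsQ arcsP simp del: vwalk_arcs.simps)
        then show "order G \<le> out_degree G c + out_degree G d"
          using ore[of c d] ore[of d c] cd arcs_symmetric[of d c] by linarith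
      qed (use Q less.prems in auto)
      with Q show ?thesis by auto
    qed
  qed
qed

section \<open>At most two heavy vertices\<close>

lemma heavy_vertsD:
  assumes "v \<in> heavy_verts G"
  shows "v \<in> pverts G" "order G \<le> 2 * card (nbrs v)"
  using assms by (auto simp: heavy_verts_def out_degree_conv)

lemma heavy_verts_le_2:
  assumes "\<nexists>p. heavy_cycle G p"
  shows "card (heavy_verts G) \<le> 2"
proof (rule ccontr)
  assume "\<not> card (heavy_verts G) \<le> 2"
  moreover have "finite (heavy_verts G)" by (simp add: heavy_verts_def)
  ultimately obtain xs where xs: "distinct xs" "set xs = heavy_verts G" "length xs \<ge> 3"
    using finite_distinct_list[of "heavy_verts G"] distinct_card by fastforce
  have "\<exists>p. graph_cycle G p \<and> set xs \<subseteq> cycle_verts p"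
  proof (rule cyclic_ore_imp_cycle)
    fix a b assume "(a, b) \<in> set (cyclic_arcs xs)"
    then have "a \<in> heavy_verts G" "b \<in> heavy_verts G" using set_cyclic_arcs xs by fastforce+
    then show "order G \<le> out_degree G a + out_degree G b"
      using heavy_vertsD(2)[of a] heavy_vertsD(2)[of b] by (simp add: out_degree_conv)
  qed (use xs in \<open>auto simp: heavy_verts_def\<close>)
  with assms xs show False by (auto simp: heavy_cycle_def)
qed

section \<open>Deletions, components and cycles through a vertex\<close>

lemma arcs_commute: "(a, b) \<in> parcs G \<longleftrightarrow> (b, a) \<in> parcs G"
  by (rule iffI; erule arcs_symmetric)

lemma pair_graph_delete_vertex: "pair_graph (delete_vertex G x)"
  by unfold_locales
    (auto simp: delete_vertex_def symmetric_def sym_def in_arcsD1 in_arcsD2 arcs_commute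
      dest: no_loops')

lemma pair_graph_delete_edge: "pair_graph (delete_edge G x y)"
  by unfold_locales
    (auto simp: delete_edge_def symmetric_def sym_def in_arcsD1 in_arcsD2 arcs_commute
      dest: no_loops')

text \<open>By symmetry, one-way reachability is already mutual.\<close>

lemma components_conv: "components G = (\<lambda>v. {w. v \<rightarrow>\<^sup>*\<^bsub>G\<^esub> w}) ` pverts G"
proof -
  have "scc_of v = {w. v \<rightarrow>\<^sup>*\<^bsub>G\<^esub> w}" for v
    unfolding scc_of_def using symmetric_reachable'[of v] by blast
  then show ?thesis by (simp add: components_def sccs_verts_conv_scc_of)
qed

lemma components_connected:
  assumes "connected G"
  shows "components G = {pverts G}"
proof -
  have "strongly_connected G"
    using assms by (intro symmetric_connected_imp_strongly_connected) auto
  then have "{w. v \<rightarrow>\<^sup>*\<^bsub>G\<^esub> w} = pverts G" if "v \<in> pverts G" for v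
    using that by (auto simp: strongly_connected_def elim: reachable_in_vertsE)
  moreover have "pverts G \<noteq> {}"
    using \<open>strongly_connected G\<close> by (auto simp: strongly_connected_def)
  ultimately show ?thesis by (auto simp: components_conv)
qed

text \<open>Closedness confines walks to \<open>S\<close>, and any two vertices of \<open>S\<close>
  are joined through the centre \<open>c\<close>. This identifies the two sides once the edge
  between the heavy vertices is deleted.\<close>

lemma reachable_star:
  assumes "c \<in> S" "S \<subseteq> pverts G" "\<And>w. w \<in> S - {c} \<Longrightarrow> (c, w) \<in> parcs G"
    and closed: "\<And>a b. (a, b) \<in> parcs G \<Longrightarrow> a \<in> S \<Longrightarrow> b \<in> S"
    and "u \<in> S"
  shows "{w. u \<rightarrow>\<^sup>*\<^bsub>G\<^esub> w} = S"
proof (intro set_eqI iffI; unfold mem_Collect_eq)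
  fix w assume "u \<rightarrow>\<^sup>*\<^bsub>G\<^esub> w"
  then show "w \<in> S"
    by (induction rule: reachable_induct) (use assms(5) closed in auto)
next
  have from_c: "c \<rightarrow>\<^sup>*\<^bsub>G\<^esub> w" if "w \<in> S" for w
    using assms(1-3) that by (cases "w = c") auto
  fix w assume "w \<in> S"
  then show "u \<rightarrow>\<^sup>*\<^bsub>G\<^esub> w"
    using from_c assms(5) symmetric_reachable' reachable_trans by meson
qed

text \<open>A walk to \<open>x\<close>, stopped just before its first visit to \<open>x\<close>,
  survives the deletion and ends at a neighbour of \<open>x\<close>.\<close>

lemma delete_vertex_reachable_nbr:
  assumes "u \<rightarrow>\<^sup>*\<^bsub>G\<^esub> x" "u \<noteq> x"
  shows "\<exists>v. u \<rightarrow>\<^sup>*\<^bsub>delete_vertex G x\<^esub> v \<and> (x, v) \<in> parcs G"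
proof -
  interpret H: pair_graph "delete_vertex G x" by (rule pair_graph_delete_vertex)
  show ?thesis
    using assms
  proof (induction rule: converse_reachable_induct)
    case (step a b)
    have ab: "(a, b) \<in> parcs G" using step.hyps(1) by simp
    show ?case
    proof (cases "b = x")
      case True
      have "a \<in> pverts (delete_vertex G x)"
        using in_arcsD1[OF ab] step.prems by (auto simp: delete_vertex_def)
      then have "a \<rightarrow>\<^sup>*\<^bsub>delete_vertex G x\<^esub> a" by simp
      with True arcs_symmetric[OF ab] show ?thesis by blast
    next
      case False
      then have adj: "(a, b) \<in> parcs (delete_vertex G x)"
        using ab step.prems by (simp add: delete_vertex_def)
      obtain v where v: "b \<rightarrow>\<^sup>*\<^bsub>delete_vertex G x\<^esub> v" "(x, v) \<in> parcs G"
        using step.IH[OF False] by (elim exE conjE)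
      with H.adj_reachable_trans[OF adj v(1)] show ?thesis by blast
    qed
  qed simp
qed

text \<open>A path from \<open>a\<close> to \<open>b\<close> avoiding \<open>x\<close> is closed up
  through \<open>x\<close>. Since \<open>a\<close> and \<open>b\<close> differ, the path has at
  least two vertices and the result is a genuine cycle.\<close>

lemma cycle_through_two_nbrs:
  assumes "(x, a) \<in> parcs G" "(x, b) \<in> parcs G" "a \<noteq> b" "a \<rightarrow>\<^sup>*\<^bsub>delete_vertex G x\<^esub> b"
  shows "\<exists>p. graph_cycle G p \<and> x \<in> cycle_verts p"
proof -
  interpret H: pair_graph "delete_vertex G x" by (rule pair_graph_delete_vertex)
  obtain p where p: "H.apath a p b" using assms(4) unfolding H.reachable_apath by (elim exE)
  define ws where "ws = pawalk_verts a p"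
  have walk: "pcas a p b" "set p \<subseteq> parcs (delete_vertex G x)" "distinct ws"
    "set ws \<subseteq> pverts (delete_vertex G x)" "hd ws = a" "last ws = b" "ws \<noteq> []"
    using p unfolding H.apath_def H.awalk_conv by (simp_all add: ws_def)
  have arcs: "vwalk_arcs ws = p"
    using vwalk_arcs_pawalk_verts[OF walk(1)] by (simp add: ws_def)
  have "length ws \<ge> 2"
    using walk assms(3) by (cases ws; cases "tl ws") auto
  moreover have "x \<notin> set ws" using walk by (auto simp: delete_vertex_def)
  moreover have "cyclic_arcs (x # ws) = (x, a) # p @ [(b, x)]"
    using walk arcs by (cases ws) (simp_all add: cyclic_arcs_conv)
  moreover have "set p \<subseteq> parcs G"
    using walk by (auto simp: delete_vertex_def)
  ultimately have "graph_cycle G (cyclic_arcs (x # ws))"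
    using assms(1) arcs_symmetric[OF assms(2)] walk by (intro graph_cycle_cyclic_arcs) auto
  then show ?thesis
    using cycle_verts_cyclic_arcs[of "x # ws"] by (intro exI[of _ "cyclic_arcs (x # ws)"]) simp
qed

text \<open>Existence comes from connectivity; two neighbours in one component would close a cycle
  through \<open>x\<close>.\<close>

lemma components_delete_vertex_one_nbr:
  assumes "connected G" "x \<in> pverts G" "\<nexists>p. graph_cycle G p \<and> x \<in> cycle_verts p"
    and "C \<in> components (delete_vertex G x)"
  shows "\<exists>!v. v \<in> C \<and> (x, v) \<in> parcs G"
proof -
  interpret H: pair_graph "delete_vertex G x" by (rule pair_graph_delete_vertex)
  obtain c where c: "c \<in> pverts G" "c \<noteq> x" and C: "C = {w. c \<rightarrow>\<^sup>*\<^bsub>delete_vertex G x\<^esub> w}"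
    using assms(4) H.components_conv by (auto simp: delete_vertex_def)
  have "c \<rightarrow>\<^sup>*\<^bsub>G\<^esub> x"
  proof -
    have "pverts G \<in> components G" using components_connected[OF assms(1)] by simp
    then show ?thesis
      using c assms(2) by (auto simp: components_def in_sccs_verts_conv_reachable)
  qed
  then have "\<exists>v. v \<in> C \<and> (x, v) \<in> parcs G"
    using delete_vertex_reachable_nbr c C by auto
  moreover have "v = w" if "v \<in> C \<and> (x, v) \<in> parcs G" "w \<in> C \<and> (x, w) \<in> parcs G" for v w
  proof (rule ccontr)
    assume "v \<noteq> w"
    moreover have "v \<rightarrow>\<^sup>*\<^bsub>delete_vertex G x\<^esub> w"
      using that C H.symmetric_reachable' H.reachable_trans by blast
    ultimately show False
      using cycle_through_two_nbrs that assms(3) by blast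
  qed
  ultimately show ?thesis by auto
qed

text \<open>Sending each component to its unique neighbour of \<open>x\<close> hits every
  neighbour.\<close>

lemma out_degree_le_card_components:
  assumes "connected G" "x \<in> pverts G" "\<nexists>p. graph_cycle G p \<and> x \<in> cycle_verts p"
  shows "out_degree G x \<le> card (components (delete_vertex G x))"
proof -
  interpret H: pair_graph "delete_vertex G x" by (rule pair_graph_delete_vertex)
  let ?f = "\<lambda>C. THE v. v \<in> C \<and> (x, v) \<in> parcs G"
  have "nbrs x \<subseteq> ?f ` components (delete_vertex G x)"
  proof
    fix v assume v: "v \<in> nbrs x"
    define C where "C = {w. v \<rightarrow>\<^sup>*\<^bsub>delete_vertex G x\<^esub> w}"
    have "v \<in> pverts (delete_vertex G x)"
      using v in_arcsD2 no_loops' by (auto simp: delete_vertex_def)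
    then have C: "C \<in> components (delete_vertex G x)" "v \<in> C"
      using H.components_conv by (auto simp: C_def)
    then have "?f C = v"
      using v by (intro the1_equality[OF components_delete_vertex_one_nbr[OF assms]]) auto
    with C show "v \<in> ?f ` components (delete_vertex G x)" by blast
  qed
  moreover have "finite (components (delete_vertex G x))"
    using H.finite_sccs_verts by (simp add: components_def)
  ultimately show ?thesis
    unfolding out_degree_conv by (rule surj_card_le[rotated])
qed

section \<open>Structure around two heavy vertices\<close>

lemma two_heavy_verts_structure:
  assumes "x \<noteq> y" "heavy_verts G = {x, y}" and no_heavy: "\<nexists>p. heavy_cycle G p"
  obtains A B where
    "pverts G = insert x A \<union> insert y B" "A \<inter> B = {}" "x \<notin> A" "x \<notin> B" "y \<notin> A" "y \<notin> B"
    "card A = card B" "(x, y) \<in> parcs G" "nbrs x = insert y A" "nbrs y = insert x B"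
    "\<And>a b. (a, b) \<in> parcs G \<Longrightarrow> a \<in> A \<Longrightarrow> b \<notin> B"
proof -
  \<comment> \<open>Any cycle through both \<open>x\<close> and \<open>y\<close> is heavy, so each
    short cycle below is refuted by listing its vertices.\<close>
  have no_cycle: False
    if "distinct xs" "length xs \<ge> 3" "set (cyclic_arcs xs) \<subseteq> parcs G" "x \<in> set xs" "y \<in> set xs" for xs
    using no_heavy graph_cycle_cyclic_arcs[OF that(1-3)] that(4,5) assms(2)
      cycle_verts_cyclic_arcs[of xs]
    by (metis empty_subsetI heavy_cycle_def insert_subset)
  have xy: "x \<in> pverts G" "y \<in> pverts G" "order G \<le> 2 * card (nbrs x)" "order G \<le> 2 * card (nbrs y)"
    using heavy_vertsD assms(2) by auto
  note [simp] = finite_nbrs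
  have card_rest: "card (pverts G - {x, y}) = order G - 2"
    using xy assms(1) by (simp add: order_def card_Diff_subset)
  have order: "order G \<ge> 2"
    using xy assms(1) card_mono[of "pverts G" "{x, y}"] by (simp add: order_def)
  have irrefl: "(v, v) \<notin> parcs G" for v using no_loops' by blast
  have edge: "(x, y) \<in> parcs G"
  proof (rule ccontr)
    assume not: "(x, y) \<notin> parcs G"
    then have not_sym: "(y, x) \<notin> parcs G" using arcs_symmetric by blast
    \<comment> \<open>Without the edge, both neighbourhoods lie among \<open>order G - 2\<close>
      vertices while their sizes sum to at least \<open>order G\<close>, so they share at least two
      vertices.\<close>
    have "card (nbrs x \<union> nbrs y) \<le> card (pverts G - {x, y})"
      using not not_sym irrefl nbrs_subset by (intro card_mono) auto
    then have "\<not> card (nbrs x \<inter> nbrs y) \<le> Suc 0"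
      using card_Un_Int[of "nbrs x" "nbrs y"] xy order by (simp add: card_rest)
    then obtain a b where ab: "a \<noteq> b" "(x, a) \<in> parcs G" "(y, a) \<in> parcs G"
        "(x, b) \<in> parcs G" "(y, b) \<in> parcs G"
      by (auto simp: card_le_Suc0_iff_eq)
    then show False
      using no_cycle[of "[x, a, y, b]"] assms(1) no_loops'[OF ab(2)] no_loops'[OF ab(3)]
        no_loops'[OF ab(4)] no_loops'[OF ab(5)] arcs_symmetric[OF ab(3)] arcs_symmetric[OF ab(4)]
      by (auto simp: cyclic_arcs_def)
  qed
  have disj: "nbrs x \<inter> nbrs y = {}"
  proof (rule ccontr)
    assume "nbrs x \<inter> nbrs y \<noteq> {}"
    then obtain z where z: "(x, z) \<in> parcs G" "(y, z) \<in> parcs G" by auto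
    then show False
      using no_cycle[of "[x, z, y]"] assms(1) no_loops'[OF z(1)] no_loops'[OF z(2)]
        arcs_symmetric[OF z(2)] arcs_symmetric[OF edge]
      by (auto simp: cyclic_arcs_def)
  qed
  define A B where "A = nbrs x - {y}" and "B = nbrs y - {x}"
  have nbrs: "nbrs x = insert y A" "nbrs y = insert x B" "y \<notin> A" "x \<notin> B" "finite A" "finite B"
    using edge arcs_symmetric[OF edge] by (auto simp: A_def B_def)
  have AB: "A \<inter> B = {}" "x \<notin> A" "y \<notin> B" "A \<union> B \<subseteq> pverts G - {x, y}"
    using disj irrefl nbrs_subset by (auto simp: A_def B_def)
  have "card A + card B = card (A \<union> B)"
    using AB nbrs by (simp add: card_Un_disjoint)
  moreover have "card (A \<union> B) \<le> order G - 2"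
    using AB by (simp add: card_mono flip: card_rest)
  moreover have "card (nbrs x) = Suc (card A)" "card (nbrs y) = Suc (card B)"
    unfolding nbrs using nbrs by auto
  \<comment> \<open>Heaviness gives each of \<open>A\<close> and \<open>B\<close> at least half of
    \<open>order G - 2\<close> elements, while together they have at most
    \<open>order G - 2\<close>; equality holds throughout.\<close>
  ultimately have cards: "card A = card B" "card (A \<union> B) = order G - 2"
    using xy order by linarith+
  have "A \<union> B = pverts G - {x, y}"
    using AB cards by (intro card_subset_eq) (simp_all add: card_rest)
  then have verts: "pverts G = insert x A \<union> insert y B" using xy by auto
  have no_AB: "b \<notin> B" if "(a, b) \<in> parcs G" "a \<in> A" for a b
  proof
    assume "b \<in> B"
    then have "(x, a) \<in> parcs G" "(y, b) \<in> parcs G" "distinct [x, a, b, y]"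
      using that AB nbrs(3,4) assms(1) by (auto simp: A_def B_def)
    then show False
      using no_cycle[of "[x, a, b, y]"] that(1) arcs_symmetric[of y b] arcs_symmetric[OF edge]
      by (simp add: cyclic_arcs_def)
  qed
  show thesis
    using that[OF verts AB(1,2) nbrs(4,3) AB(3) cards(1) edge nbrs(1,2) no_AB] .
qed

end

text \<open>Tail and head are \<open>fst\<close> and \<open>snd\<close> in every pair digraph, so
  compatibility is automatic.\<close>

lemma subgraph_pair_graphI:
  assumes "pair_wf_digraph H" "pair_wf_digraph G" "pverts H \<subseteq> pverts G" "parcs H \<subseteq> parcs G"
  shows "subgraph H G"
  using assms by (auto simp: subgraph_def wf_digraph_wp_iff compatible_def)

section \<open>Assembly of the cases\<close>

theorem theorem2:
  fixes G :: "'a pair_pre_digraph" and n :: nat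
  assumes "pair_graph G"
    and "connected G"
    and "n = order G"
    and no_heavy_cycle: "\<nexists>p. heavy_cycle G p"
  shows "card (heavy_verts G) \<le> 2 \<and>
    (heavy_verts G = {} \<longrightarrow> graph_tree G) \<and>
    (\<forall>x. heavy_verts G = {x} \<longrightarrow>
      real (card (components (delete_vertex G x))) \<ge> real n / 2 \<and>
      (\<forall>C \<in> components (delete_vertex G x). \<exists>!v. v \<in> C \<and> (x, v) \<in> parcs G)) \<and>
    (\<forall>x y. x \<noteq> y \<and> heavy_verts G = {x, y} \<longrightarrow>
      (x, y) \<in> parcs G \<and> cut_edge G x y \<and> even n \<and>
      card (components (delete_edge G x y)) = 2 \<and>
      (\<forall>C \<in> components (delete_edge G x y). real (card C) = real n / 2) \<and>
      (\<forall>C \<in> components (delete_edge G x y). x \<in> C \<longrightarrow> (\<forall>v \<in> C - {x}. (x, v) \<in> parcs G)) \<and>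
      (\<forall>C \<in> components (delete_edge G x y). y \<in> C \<longrightarrow> (\<forall>v \<in> C - {y}. (y, v) \<in> parcs G)) \<and>
      (\<exists>xs ys. T_labelling n x xs y ys \<and>
        subgraph (T1 x xs y ys) G \<and> subgraph G (T2 x xs y ys)))"
proof (rule conjI[OF _ conjI[OF _ conjI]]; ((rule allI impI)+)?)
  interpret pair_graph G by fact
  show "card (heavy_verts G) \<le> 2"
    using heavy_verts_le_2 no_heavy_cycle by blast
  \<comment> \<open>Without heavy vertices every cycle is vacuously heavy.\<close>
  show "graph_tree G" if "heavy_verts G = {}"
    using that assms by (auto simp: graph_tree_def heavy_cycle_def)
  show "real (card (components (delete_vertex G x))) \<ge> real n / 2 \<and>
      (\<forall>C \<in> components (delete_vertex G x). \<exists>!v. v \<in> C \<and> (x, v) \<in> parcs G)"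
    if x: "heavy_verts G = {x}" for x
  proof -
    have heavy: "x \<in> pverts G" "real n / 2 \<le> real (out_degree G x)"
      using x assms(3) by (auto simp: heavy_verts_def)
    have no_cycle: "\<nexists>p. graph_cycle G p \<and> x \<in> cycle_verts p"
      using x no_heavy_cycle by (auto simp: heavy_cycle_def)
    have "real (out_degree G x) \<le> real (card (components (delete_vertex G x)))"
      using out_degree_le_card_components[OF assms(2) heavy(1) no_cycle] by simp
    with heavy(2) components_delete_vertex_one_nbr[OF assms(2) heavy(1) no_cycle] show ?thesis
      by auto
  qed
  fix x y assume xy: "x \<noteq> y \<and> heavy_verts G = {x, y}"
  obtain A B where AB: "pverts G = insert x A \<union> insert y B" "A \<inter> B = {}"
      "x \<notin> A" "x \<notin> B" "y \<notin> A" "y \<notin> B" and card_eq: "card A = card B"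
    and edge: "(x, y) \<in> parcs G" and nbrs: "nbrs x = insert y A" "nbrs y = insert x B"
    and no_AB: "\<And>a b. (a, b) \<in> parcs G \<Longrightarrow> a \<in> A \<Longrightarrow> b \<notin> B"
    by (rule two_heavy_verts_structure[OF conjunct1[OF xy] conjunct2[OF xy] no_heavy_cycle])
      (rule that)
  define H where "H = delete_edge G x y"
  interpret H: pair_graph H unfolding H_def by (rule pair_graph_delete_edge)
  have fin: "finite A" "finite B"
    using finite_verts AB(1) by auto
  have n: "n = 2 * Suc (card A)"
    using AB(2-6) conjunct1[OF xy] fin card_eq
    unfolding assms(3) order_def AB(1) by (auto simp: card_Un_disjoint card_insert_if)
  have adj: "(x, a) \<in> parcs G \<longleftrightarrow> a = y \<or> a \<in> A" "(y, a) \<in> parcs G \<longleftrightarrow> a = x \<or> a \<in> B" for a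
    using nbrs by auto
  have adj': "(a, x) \<in> parcs G \<longleftrightarrow> a = y \<or> a \<in> A" "(a, y) \<in> parcs G \<longleftrightarrow> a = x \<or> a \<in> B" for a
    using adj[of a] arcs_symmetric[of a x] arcs_symmetric[of x a]
      arcs_symmetric[of a y] arcs_symmetric[of y a] by blast+
  \<comment> \<open>Once the edge \<open>xy\<close> is gone, \<open>x\<close> sees only
    \<open>A\<close>, \<open>y\<close> sees only \<open>B\<close>, and \<open>no_AB\<close> excludes
    arcs between \<open>A\<close> and \<open>B\<close>.\<close>
  have same_side: "a \<in> insert x A \<and> b \<in> insert x A \<or> a \<in> insert y B \<and> b \<in> insert y B"
    if "(a, b) \<in> parcs H" for a b
  proof -
    have ab: "(a, b) \<in> parcs G" "(a, b) \<noteq> (x, y)" "(a, b) \<noteq> (y, x)"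
      using that by (auto simp: H_def delete_edge_def)
    then have "a \<in> insert x A \<union> insert y B" "b \<in> insert x A \<union> insert y B"
      using in_arcsD1 in_arcsD2 AB(1) by blast+
    with ab show ?thesis
      using no_AB[of a b] no_AB[of b a] arcs_symmetric[of a b] adj[of a] adj[of b] adj'[of a] adj'[of b] AB
      by blast
  qed
  have side_x: "{w. u \<rightarrow>\<^sup>*\<^bsub>H\<^esub> w} = insert x A" if "u \<in> insert x A" for u
    using that same_side AB xy adj
    by (intro H.reachable_star[of x]) (auto simp: H_def delete_edge_def)
  have side_y: "{w. u \<rightarrow>\<^sup>*\<^bsub>H\<^esub> w} = insert y B" if "u \<in> insert y B" for u
    using that same_side AB xy adj
    by (intro H.reachable_star[of y]) (auto simp: H_def delete_edge_def)
  have "pverts H = insert x A \<union> insert y B"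
    using AB by (simp add: H_def delete_edge_def)
  then have comps: "components H = {insert x A, insert y B}"
    using side_x side_y by (auto simp: H.components_conv image_Un simp del: Un_insert_left Un_insert_right)
  have card_comps: "card (components H) = 2"
    using AB xy by (auto simp: comps card_insert_if)
  \<comment> \<open>Connectedness leaves one component before the deletion, against two after
    it.\<close>
  have cut: "cut_edge G x y"
    using edge card_comps components_connected assms(2) by (simp add: cut_edge_def H_def)
  obtain xs ys where lists: "set xs = A" "distinct xs" "set ys = B" "distinct ys"
    using finite_distinct_list fin by metis
  \<comment> \<open>By \<open>n\<close>, the length \<open>n div 2 - 1\<close> is exactly
    \<open>card A\<close>.\<close>
  have label: "T_labelling n x xs y ys"
    using lists AB xy n card_eq distinct_card[of xs] distinct_card[of ys]
    by (auto simp: T_labelling_def)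
  have wf: "pair_wf_digraph G" by unfold_locales
  have "subgraph (T1 x xs y ys) G"
  proof (rule subgraph_pair_graphI)
    show "pair_wf_digraph (T1 x xs y ys)"
      by (auto simp: T1_def symcl_def pair_wf_digraph_def)
  qed (use lists AB adj adj' wf in \<open>auto simp: T1_def symcl_def\<close>)
  moreover have "subgraph G (T2 x xs y ys)"
  proof (rule subgraph_pair_graphI)
    show "parcs G \<subseteq> parcs (T2 x xs y ys)"
    proof
      fix e assume e: "e \<in> parcs G"
      obtain a b where ab: "e = (a, b)" by (cases e)
      have "a \<noteq> b" using e ab no_loops' by blast
      show "e \<in> parcs (T2 x xs y ys)"
      \<comment> \<open>Arcs of \<open>H\<close> stay within one clique of \<open>T2\<close>; the
        others are the two orientations of \<open>xy\<close>.\<close>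
      proof (cases "(a, b) \<in> parcs H")
        case True
        then show ?thesis
          using same_side \<open>a \<noteq> b\<close> lists by (fastforce simp: T2_def symcl_def ab)
      next
        case False
        then show ?thesis
          using e by (auto simp: T2_def symcl_def ab H_def delete_edge_def)
      qed
    qed
    show "pair_wf_digraph (T2 x xs y ys)"
      by (auto simp: T2_def symcl_def pair_wf_digraph_def)
  qed (use lists AB wf in \<open>auto simp: T2_def\<close>)
  ultimately have "\<exists>xs ys. T_labelling n x xs y ys \<and>
      subgraph (T1 x xs y ys) G \<and> subgraph G (T2 x xs y ys)"
    using label by blast
  moreover have "real (card (insert x A)) = real n / 2" "real (card (insert y B)) = real n / 2" "even n"
    using AB fin card_eq n by simp_all
  then have "\<forall>C \<in> components H. real (card C) = real n / 2" "even n"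
    by (simp_all add: comps)
  moreover have "\<forall>C \<in> components H. x \<in> C \<longrightarrow> (\<forall>v \<in> C - {x}. (x, v) \<in> parcs G)"
    "\<forall>C \<in> components H. y \<in> C \<longrightarrow> (\<forall>v \<in> C - {y}. (y, v) \<in> parcs G)"
    using conjunct1[OF xy] AB(3-6) by (auto simp: comps adj)
  ultimately show "(x, y) \<in> parcs G \<and> cut_edge G x y \<and> even n \<and>
      card (components (delete_edge G x y)) = 2 \<and>
      (\<forall>C \<in> components (delete_edge G x y). real (card C) = real n / 2) \<and>
      (\<forall>C \<in> components (delete_edge G x y). x \<in> C \<longrightarrow> (\<forall>v \<in> C - {x}. (x, v) \<in> parcs G)) \<and>
      (\<forall>C \<in> components (delete_edge G x y). y \<in> C \<longrightarrow> (\<forall>v \<in> C - {y}. (y, v) \<in> parcs G)) \<and>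
      (\<exists>xs ys. T_labelling n x xs y ys \<and>
        subgraph (T1 x xs y ys) G \<and> subgraph G (T2 x xs y ys))"
    using edge cut card_comps unfolding H_def by - (intro conjI; assumption)
qed

end
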